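(* Let $\mathcal{A}\in T_{m,n}$ be an even order row diagonal column competent tensor. Then for every $q\in\mathbb{R}^n$, any $\omega$-solution of the tensor complementarity problem TCP$(q,\mathcal{A})$, if it exists, is locally $\omega$-unique.
   Context: $T_{m,n}$ is the set of real tensors $\mathcal{A}=(a_{i_1 i_2\ldots i_m})$ of order $m$ and dimension $n$ (with $i_1,\ldots,i_m\in[n]=\{1,\ldots,n\}$, $m,n$ positive integers, $m\ge 2$). For $x\in\mathbb{R}^n$, $\mathcal{A}x^{m-1}\in\mathbb{R}^n$ is the vector with $(\mathcal{A}x^{m-1})_i=\sum_{i_2,\ldots,i_m=1}^n a_{i i_2\ldots i_m}x_{i_2}\cdots x_{i_m}$. A tensor $\mathcal{A}\in T_{m,n}$ is column competent if, for $x\in\mathbb{R}^n$, $x_i(\mathcal{A}x^{m-1})_i=0$ for all $i\in[n]$ implies $\mathcal{A}x^{m-1}=0$. $\mathcal{A}$ is row diagonal if $a_{i i_2\ldots i_m}$ can be nonzero only when $i_2=\cdots=i_m$. For $q\in\mathbb{R}^n$, TCP$(q,\mathcal{A})$ is to find $x\in\mathbb{R}^n$ with $x\ge 0$, $\omega=\mathcal{A}x^{m-1}+q\ge 0$ and $x^T\omega=0$ (inequalities componentwise); such a pair $(\omega,x)$ is a solution, and a vector $\omega$ is an $\omega$-solution if there exists $x$ such that $(\omega,x)$ is a solution. An $\omega$-solution $\tilde{\omega}$ is locally $\omega$-unique if there is a neighborhood of $\tilde{\omega}$ within which $\tilde{\omega}$ is the only $\omega$-solution. *)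

theory Defs
  imports "HOL-Analysis.Analysis"
begin

text \<open>
  A real tensor of order \<open>m\<close> and dimension \<open>CARD('n)\<close> maps the index list
  \<open>[i\<^sub>1, \<dots>, i\<^sub>m]\<close> to its entry. Lists of any other length carry no information and are sent to 0,
  so that \<open>tensors m\<close> is in bijection with the arrays of order \<open>m\<close>.
\<close>

type_synonym 'n tensor = "'n list \<Rightarrow> real"

definition tensors :: "nat \<Rightarrow> 'n::finite tensor set" where
  "tensors m = {A. \<forall>is. length is \<noteq> m \<longrightarrow> A is = 0}"

definition tensor_apply :: "nat \<Rightarrow> 'n::finite tensor \<Rightarrow> real ^ 'n \<Rightarrow> real ^ 'n" where
  "tensor_apply m A x =
    (\<chi> i. \<Sum>js | length js = m - 1. A (i # js) * (\<Prod>j\<leftarrow>js. x $ j))"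

definition column_competent :: "nat \<Rightarrow> 'n::finite tensor \<Rightarrow> bool" where
  "column_competent m A \<longleftrightarrow>
    (\<forall>x. (\<forall>i. x $ i * tensor_apply m A x $ i = 0) \<longrightarrow> tensor_apply m A x = 0)"

definition row_diagonal :: "nat \<Rightarrow> 'n::finite tensor \<Rightarrow> bool" where
  "row_diagonal m A \<longleftrightarrow>
    (\<forall>i js. length js = m - 1 \<and> A (i # js) \<noteq> 0 \<longrightarrow> (\<forall>j\<in>set js. \<forall>k\<in>set js. j = k))"

text \<open>The order on \<open>real ^ 'n\<close> is the componentwise one.\<close>

definition TCP_solution ::
  "nat \<Rightarrow> real ^ 'n::finite \<Rightarrow> 'n tensor \<Rightarrow> real ^ 'n \<Rightarrow> real ^ 'n \<Rightarrow> bool" where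
  "TCP_solution m q A w x \<longleftrightarrow>
    0 \<le> x \<and> w = tensor_apply m A x + q \<and> 0 \<le> w \<and> x \<bullet> w = 0"

definition omega_solution ::
  "nat \<Rightarrow> real ^ 'n::finite \<Rightarrow> 'n tensor \<Rightarrow> real ^ 'n \<Rightarrow> bool" where
  "omega_solution m q A w \<longleftrightarrow> (\<exists>x. TCP_solution m q A w x)"

definition locally_omega_unique ::
  "nat \<Rightarrow> real ^ 'n::finite \<Rightarrow> 'n tensor \<Rightarrow> real ^ 'n \<Rightarrow> bool" where
  "locally_omega_unique m q A w \<longleftrightarrow>
    omega_solution m q A w \<and>
    (\<exists>U. open U \<and> w \<in> U \<and> (\<forall>w'\<in>U. omega_solution m q A w' \<longrightarrow> w' = w))"

end

theory Submission
  imports Defs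
begin

text \<open>
  For a row diagonal tensor, \<open>\<A>x\<^sup>m\<^sup>-\<^sup>1\<close> is linear in the vector of powers \<open>x\<^sub>j\<^sup>m\<^sup>-\<^sup>1\<close>, and every real vector
  is such a vector of powers since \<open>m - 1\<close> is odd. So if two solutions \<open>(\<omega>, x)\<close> and \<open>(\<omega>', x')\<close> are
  such that \<open>\<omega>\<close> and \<open>\<omega>'\<close> have the same zero set, then the \<open>y\<close> with
  \<open>y\<^sub>j\<^sup>m\<^sup>-\<^sup>1 = x\<^sub>j\<^sup>m\<^sup>-\<^sup>1 - x'\<^sub>j\<^sup>m\<^sup>-\<^sup>1\<close> satisfies \<open>\<A>y\<^sup>m\<^sup>-\<^sup>1 = \<omega> - \<omega>'\<close> and, by complementarity,
  \<open>y\<^sub>i (\<omega> - \<omega>')\<^sub>i = 0\<close> for all \<open>i\<close>; column competence gives \<open>\<omega> = \<omega>'\<close>. An \<open>\<omega>\<close>-solution is thus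
  determined by its zero set, so there are only finitely many of them.
\<close>

text \<open>Only constant lists \<open>js\<close> contribute to the sum. Since
  \<open>m - 1 > 0\<close>, they are nonempty and correspond one-to-one to their common entry
  \<open>j\<close>.\<close>

lemma tensor_apply_row_diagonal:
  fixes A :: "'n::finite tensor"
  assumes "m \<ge> 2" and "row_diagonal m A"
  shows "tensor_apply m A x $ i = (\<Sum>j\<in>UNIV. A (i # replicate (m - 1) j) * x $ j ^ (m - 1))"
proof -
  let ?f = "\<lambda>js. A (i # js) * (\<Prod>j\<leftarrow>js. x $ j)"
  let ?R = "range (\<lambda>j::'n. replicate (m - 1) j)"
  have fin: "finite {js::'n list. length js = m - 1}"
    using finite_lists_length_eq[of "UNIV::'n set" "m - 1"] by simp
  have zero: "?f js = 0" if "js \<in> {js. length js = m - 1} - ?R" for js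
  proof (rule ccontr)
    assume "?f js \<noteq> 0"
    then have "\<forall>j\<in>set js. \<forall>k\<in>set js. j = k"
      using assms(2) that by (auto simp: row_diagonal_def)
    moreover have "hd js \<in> set js"
      using that assms(1) by (intro hd_in_set) auto
    ultimately have "js = replicate (length js) (hd js)"
      by (intro replicate_eqI) auto
    with that show False
      by auto
  qed
  have "inj (\<lambda>j::'n. replicate (m - 1) j)"
    using assms(1) by (intro injI) (simp add: replicate_eq_replicate)
  then have "sum ?f ?R = (\<Sum>j\<in>UNIV. A (i # replicate (m - 1) j) * x $ j ^ (m - 1))"
    by (simp add: sum.reindex prod_list_replicate)
  moreover have "sum ?f {js. length js = m - 1} = sum ?f ?R"
    using fin zero by (intro sum.mono_neutral_right) auto
  ultimately show ?thesis
    by (simp add: tensor_apply_def)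
qed

lemma TCP_solution_complementary:
  assumes "TCP_solution m q A w x"
  shows "x $ i = 0 \<or> w $ i = 0"
proof -
  have "\<forall>i. 0 \<le> x $ i * w $ i" and "(\<Sum>i\<in>UNIV. x $ i * w $ i) = 0"
    using assms by (auto simp: TCP_solution_def less_eq_vec_def inner_vec_def)
  then have "x $ i * w $ i = 0"
    by (simp add: sum_nonneg_eq_0_iff)
  then show ?thesis
    by simp
qed

lemma omega_solution_eqI:
  assumes m: "m \<ge> 2" "even m" and A: "row_diagonal m A" "column_competent m A"
    and w: "omega_solution m q A w" "omega_solution m q A w'"
    and zeros: "{i. w $ i = 0} = {i. w' $ i = 0}"
  shows "w = w'"
proof -
  obtain x x' where x: "TCP_solution m q A w x" and x': "TCP_solution m q A w' x'"
    using w by (auto simp: omega_solution_def)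
  have odd: "odd (m - 1)"
    using m by simp
  define y where "y = (\<chi> j. root (m - 1) (x $ j ^ (m - 1) - x' $ j ^ (m - 1)))"
  have "tensor_apply m A y = tensor_apply m A x - tensor_apply m A x'"
    using odd by (simp add: vec_eq_iff tensor_apply_row_diagonal[OF m(1) A(1)] y_def
        odd_real_root_pow right_diff_distrib sum_subtractf)
  then have Ay: "tensor_apply m A y = w - w'"
    using x x' by (simp add: TCP_solution_def)
  have "y $ i * tensor_apply m A y $ i = 0" for i
  proof (cases "w $ i = 0")
    case True
    with zeros show ?thesis
      by (auto simp: Ay)
  next
    \<comment> \<open>By \<open>zeros\<close>, \<open>w' $ i\<close> is nonzero too, so
      complementarity makes both \<open>x $ i\<close> and \<open>x' $ i\<close> vanish.\<close>
    case False
    with zeros have "x $ i = 0" "x' $ i = 0"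
      using TCP_solution_complementary[OF x, of i] TCP_solution_complementary[OF x', of i] by auto
    then show ?thesis
      by (simp add: y_def)
  qed
  then have "tensor_apply m A y = 0"
    using A(2) by (simp add: column_competent_def)
  with Ay show ?thesis
    by simp
qed

lemma finite_omega_solutions:
  fixes A :: "'n::finite tensor"
  assumes "m \<ge> 2" "even m" "row_diagonal m A" "column_competent m A"
  shows "finite {w. omega_solution m q A w}"
proof (rule finite_imageD)
  show "finite ((\<lambda>w. {i. w $ i = 0}) ` {w. omega_solution m q A w})"
    by simp
  show "inj_on (\<lambda>w. {i. w $ i = 0}) {w. omega_solution m q A w}"
    using omega_solution_eqI[OF assms] by (auto intro!: inj_onI)
qed

theorem corollary3p3:
  fixes A :: "'n::finite tensor" and m :: nat
  assumes "m \<ge> 2" and "A \<in> tensors m"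
    and "even m"
    and "row_diagonal m A"
    and "column_competent m A"
  shows "\<forall>q w. omega_solution m q A w \<longrightarrow> locally_omega_unique m q A w"
proof (intro allI impI)
  fix q w
  assume w: "omega_solution m q A w"
  \<comment> \<open>Removing the finitely many other solutions, a closed set, leaves an open
    neighbourhood of \<open>w\<close>.\<close>
  let ?U = "- ({w'. omega_solution m q A w'} - {w})"
  have "open ?U"
    using finite_omega_solutions[OF assms(1,3,4,5)] by (intro open_Compl finite_imp_closed) simp
  with w show "locally_omega_unique m q A w"
    unfolding locally_omega_unique_def by (intro conjI exI[of _ ?U]) auto
qed

end
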